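(* Let $D^*=(V,A^* )$ be a strongly connected digraph, let $F\subseteq A^*$ be a flat subset of edges, and let $k\ge 1$ be an integer. A subset $S\subseteq V$ is the union of $k$ $F$-stable sets if and only if $$|S\cap V(K)|\le k\,|F\cap K|\quad\text{for every di-circuit } K \text{ of } D^*.$$ In particular, if $|V|\ge 2$ and $F$ is a flat transversal of di-circuits, then the minimum number of $F$-stable sets covering $S$ is equal to $$\max\left\{\left\lceil \frac{|S\cap V(K)|}{|F\cap K|}\right\rceil : K \text{ a di-circuit of } D^*\right\}.$$
   Context: Digraphs are finite and loopless; parallel and oppositely directed edges are allowed. A di-circuit is a directed circuit (two oppositely directed edges between the same two nodes form a di-circuit); $K$ also denotes the edge-set of the di-circuit and $V(K)$ its node-set. An edge is cyclic if it belongs to a di-circuit. A subset $F$ of edges is flat if every cyclic edge belongs to a di-circuit containing exactly one element of $F$. $F$ is a flat transversal of di-circuits if every di-circuit contains an element of $F$ and every cyclic edge belongs to a di-circuit containing exactly one element of $F$. A directed cut (dicut) of a digraph is the set of edges entering a subset $Z$ of nodes, provided no edge leaves $Z$. A sink node is a node with no leaving edge; a sink set is a set of nodes each of which is a sink. A set of nodes is sink-stable in a digraph if there are pairwise edge-disjoint dicuts of the digraph such that, after reversing the orientation of all edges of these dicuts, the set becomes a sink set. A set of nodes is $F$-stable in $D^*$ if it is sink-stable in the digraph $D^*_F$ arising from $D^*$ by reversing the edges in $F$. *)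

theory Defs
  imports Complex_Main "HOL-Library.Disjoint_Sets" "Graph_Theory.Digraph_Component"
begin

text \<open>Di-circuits are represented by their edge sets.  In a digraph without loops,
  \<^const>\<open>pre_digraph.cycle\<close> is a closed walk with at least two arcs and no repeated node.\<close>

definition dicircuit :: "('a, 'b) pre_digraph \<Rightarrow> 'b set \<Rightarrow> bool" where
  "dicircuit G K \<longleftrightarrow> (\<exists>p. pre_digraph.cycle G p \<and> K = set p)"

definition dicircuit_verts :: "('a, 'b) pre_digraph \<Rightarrow> 'b set \<Rightarrow> 'a set" where
  "dicircuit_verts G K = tail G ` K \<union> head G ` K"

definition cyclic_arc :: "('a, 'b) pre_digraph \<Rightarrow> 'b \<Rightarrow> bool" where
  "cyclic_arc G e \<longleftrightarrow> (\<exists>K. dicircuit G K \<and> e \<in> K)"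

definition flat :: "('a, 'b) pre_digraph \<Rightarrow> 'b set \<Rightarrow> bool" where
  "flat G F \<longleftrightarrow> F \<subseteq> arcs G \<and>
     (\<forall>e. cyclic_arc G e \<longrightarrow> (\<exists>K. dicircuit G K \<and> e \<in> K \<and> card (F \<inter> K) = 1))"

definition flat_transversal :: "('a, 'b) pre_digraph \<Rightarrow> 'b set \<Rightarrow> bool" where
  "flat_transversal G F \<longleftrightarrow> flat G F \<and> (\<forall>K. dicircuit G K \<longrightarrow> F \<inter> K \<noteq> {})"

definition entering_arcs :: "('a, 'b) pre_digraph \<Rightarrow> 'a set \<Rightarrow> 'b set" where
  "entering_arcs G Z = {e \<in> arcs G. tail G e \<notin> Z \<and> head G e \<in> Z}"

definition leaving_arcs :: "('a, 'b) pre_digraph \<Rightarrow> 'a set \<Rightarrow> 'b set" where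
  "leaving_arcs G Z = {e \<in> arcs G. tail G e \<in> Z \<and> head G e \<notin> Z}"

definition dicut :: "('a, 'b) pre_digraph \<Rightarrow> 'b set \<Rightarrow> bool" where
  "dicut G C \<longleftrightarrow> (\<exists>Z \<subseteq> verts G. leaving_arcs G Z = {} \<and> C = entering_arcs G Z)"

definition reverse_arcs :: "('a, 'b) pre_digraph \<Rightarrow> 'b set \<Rightarrow> ('a, 'b) pre_digraph" where
  "reverse_arcs G F = \<lparr> verts = verts G, arcs = arcs G,
     tail = (\<lambda>e. if e \<in> F then head G e else tail G e),
     head = (\<lambda>e. if e \<in> F then tail G e else head G e) \<rparr>"

definition sink_set :: "('a, 'b) pre_digraph \<Rightarrow> 'a set \<Rightarrow> bool" where
  "sink_set G X \<longleftrightarrow> X \<subseteq> verts G \<and> (\<forall>v \<in> X. out_arcs G v = {})"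

definition sink_stable :: "('a, 'b) pre_digraph \<Rightarrow> 'a set \<Rightarrow> bool" where
  "sink_stable G X \<longleftrightarrow> (\<exists>\<C>. (\<forall>C \<in> \<C>. dicut G C) \<and> disjoint \<C> \<and>
     sink_set (reverse_arcs G (\<Union>\<C>)) X)"

definition F_stable :: "('a, 'b) pre_digraph \<Rightarrow> 'b set \<Rightarrow> 'a set \<Rightarrow> bool" where
  "F_stable G F X \<longleftrightarrow> sink_stable (reverse_arcs G F) X"

text \<open>The \<open>k\<close> sets of the union need not be distinct, and some of them may be empty.\<close>

definition union_of_F_stable :: "('a, 'b) pre_digraph \<Rightarrow> 'b set \<Rightarrow> nat \<Rightarrow> 'a set \<Rightarrow> bool" where
  "union_of_F_stable G F k S \<longleftrightarrow>
     (\<exists>T :: nat \<Rightarrow> 'a set. (\<forall>i<k. F_stable G F (T i)) \<and> S = (\<Union>i<k. T i))"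

definition F_stable_cover :: "('a, 'b) pre_digraph \<Rightarrow> 'b set \<Rightarrow> 'a set \<Rightarrow> 'a set set \<Rightarrow> bool" where
  "F_stable_cover G F S \<T> \<longleftrightarrow> finite \<T> \<and> (\<forall>X \<in> \<T>. F_stable G F X) \<and> S \<subseteq> \<Union>\<T>"

end

theory Submission
  imports Defs
begin

text \<open>
  Everything rests on translating stability into integer potentials.  Pairwise disjoint dicuts of a
  digraph correspond to potentials \<open>\<pi>\<close> on the nodes that grow by 0 or 1 along every arc: given the
  dicuts, \<open>\<pi> v\<close> counts those whose in-side contains \<open>v\<close>; given \<open>\<pi>\<close>, the dicuts are its level cuts.
  The arcs in the dicuts are the ones where \<open>\<pi>\<close> grows by 1.  Applied to the digraph with \<open>F\<close> reversed
  and rewritten in the original orientation, this says that \<open>X\<close> is \<open>F\<close>-stable iff some function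
  \<open>c e = [e \<in> F] + \<pi> (head e) - \<pi> (tail e)\<close> has all its values in \<open>{0, 1}\<close>, is 1 on the arcs
  leaving \<open>X\<close> and 0 on the arcs entering \<open>X\<close> (\<open>F_stable_iff_shifted_indicator\<close>).

  Necessity of the bound is then immediate.  Potential differences cancel around a di-circuit \<open>K\<close>,
  so \<open>c\<close> sums to \<open>|F \<inter> K|\<close> on \<open>K\<close>, while the arc of \<open>K\<close> leaving a node of \<open>X\<close> contributes 1
  (\<open>card_F_stable_dicircuit_le\<close>); summing over \<open>k\<close> stable sets gives the factor \<open>k\<close>.

  For sufficiency, the bound says that the arc weights \<open>k [e \<in> F] - [tail e \<in> S]\<close> are nonnegative on
  every di-circuit, so they admit an integer potential \<open>\<pi>\<close> with
  \<open>\<pi> (tail e) + [tail e \<in> S] \<le> \<pi> (head e) + k [e \<in> F]\<close> (\<open>feasible_potential\<close>).  Divide it by \<open>k\<close>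
  with the \<open>k\<close> possible roundings: \<open>\<pi>\<^sub>i = (\<pi> + i) div k\<close> for \<open>i < k\<close>.  Each \<open>\<pi>\<^sub>i\<close> satisfies the
  inequality for \<open>k = 1\<close> without the term for \<open>S\<close>, since \<open>div\<close> is monotone; and for a node \<open>v\<close> of \<open>S\<close>
  the extra 1 survives the rounding for exactly the \<open>i\<close> with \<open>k dvd \<pi> v + i + 1\<close>.  Distributing the
  nodes of \<open>S\<close> by this \<open>i\<close> splits \<open>S\<close> into \<open>k\<close> sets, each coming with a function \<open>c\<close> that is
  nonnegative and at least 1 on the arcs leaving the set.  Strong connectivity and flatness supply the
  missing upper bounds: every arc lies on a di-circuit on which \<open>c\<close> sums to 1
  (\<open>F_stable_if_shifted_indicator_ge\<close>).

  The min-max formula is a reformulation, because for a transversal \<open>F\<close> the bound for \<open>k\<close> states that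
  \<open>k\<close> is at least each of the rounded ratios, and because subsets of stable sets are stable.
\<close>

section \<open>Di-circuits\<close>

lemma (in wf_digraph) dicircuit_arcs:
  assumes "dicircuit G K"
  shows "K \<subseteq> arcs G" "finite K"
  using assms by (auto simp: dicircuit_def cycle_def)

text \<open>
  These facts allow sums over a di-circuit to be reindexed by its nodes, through the tails or through
  the heads.  They hold because the list of heads of a cycle is the list of tails rotated by one.
\<close>

lemma (in wf_digraph) dicircuit_ends:
  assumes "dicircuit G K"
  shows "inj_on (tail G) K" "inj_on (head G) K" "head G ` K = tail G ` K"
proof -
  obtain p u where K: "K = set p" and walk: "awalk u p u"
    and dist: "distinct (tl (awalk_verts u p))" and ne: "p \<noteq> []"
    using assms by (auto simp: dicircuit_def cycle_def)
  have cas: "cas u p u"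
    using walk by blast
  have "map (tail G) p @ [head G (last p)] = tail G (hd p) # map (head G) p"
    using awalk_verts_conv[of u p] awalk_verts_conv'[OF cas] ne by simp
  moreover have "tail G (hd p) = u"
    using cas ne cas_simp by blast
  moreover have "head G (last p) = u"
    using awlast_if_cas[OF cas] ne by (simp add: awalk_verts_conv)
  ultimately have rot: "rotate1 (map (tail G) p) = map (head G) p"
    using ne by (cases p) auto
  have heads: "distinct (map (head G) p)"
    using dist awalk_verts_conv'[OF cas] ne by simp
  then have tails: "distinct (map (tail G) p)"
    by (metis rot distinct1_rotate)
  show "inj_on (tail G) K" "inj_on (head G) K"
    using heads tails by (simp_all add: K distinct_map)
  show "head G ` K = tail G ` K"
    by (metis K rot set_map set_rotate1)
qed

lemma (in wf_digraph) sum_tails_dicircuit: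
  assumes "dicircuit G K"
  shows "(\<Sum>e\<in>K. of_bool (tail G e \<in> X) :: int) = int (card (X \<inter> dicircuit_verts G K))"
proof -
  have "(\<Sum>e\<in>K. of_bool (tail G e \<in> X) :: int) = (\<Sum>v\<in>tail G ` K. of_bool (v \<in> X))"
    using dicircuit_ends(1)[OF assms] by (simp add: sum.reindex)
  also have "tail G ` K = dicircuit_verts G K"
    using dicircuit_ends(3)[OF assms] by (simp add: dicircuit_verts_def)
  also have "(\<Sum>v\<in>dicircuit_verts G K. of_bool (v \<in> X) :: int) = int (card (X \<inter> dicircuit_verts G K))"
    using dicircuit_arcs(2)[OF assms]
    by (simp add: dicircuit_verts_def of_bool_def sum.If_cases Int_commute)
  finally show ?thesis .
qed

lemma (in loopfree_digraph) cyclic_arc_if_strongly_connected: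
  assumes "strongly_connected G" and "e \<in> arcs G"
  shows "cyclic_arc G e"
proof -
  have "head G e \<rightarrow>\<^sup>* tail G e"
    using assms by (auto simp: strongly_connected_def)
  then obtain p where "apath (head G e) p (tail G e)"
    using reachable_apath by blast
  then have "cycle (e # p)"
    using assms(2) by (auto simp: cycle_def apath_def awalk_Cons_iff)
  then show ?thesis
    unfolding cyclic_arc_def dicircuit_def by (intro exI[of _ "set (e # p)"]) auto
qed

text \<open>
  In the formula with the maximum, this provides a di-circuit to start with, and it shows that only
  \<open>S = {}\<close> has maximum 0.
\<close>

lemma (in loopfree_digraph) dicircuit_through_vertex:
  assumes sc: "strongly_connected G" and "2 \<le> card (verts G)" and v: "v \<in> verts G"
  obtains K where "dicircuit G K" "v \<in> dicircuit_verts G K"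
proof -
  obtain w where "w \<in> verts G" "w \<noteq> v"
    using assms(2) by (metis card_le_Suc0_iff_eq card.infinite not_less_eq_eq numeral_2_eq_2 v zero_le)
  then have "v \<rightarrow>\<^sup>* w"
    using sc v by (auto simp: strongly_connected_def)
  then obtain p where p: "awalk v p w"
    using reachable_awalk by blast
  then obtain e q where "p = e # q"
    using \<open>w \<noteq> v\<close> by (cases p) (auto simp: awalk_Nil_iff)
  then have "e \<in> arcs G" "tail G e = v"
    using p by (auto simp: awalk_Cons_iff)
  then obtain K where "dicircuit G K" "e \<in> K"
    using cyclic_arc_if_strongly_connected[OF sc] unfolding cyclic_arc_def by blast
  then show ?thesis
    using that \<open>tail G e = v\<close> by (auto simp: dicircuit_verts_def)
qed

section \<open>Stable sets and potentials\<close>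

text \<open>
  The indicator function of \<open>F\<close> modified by a coboundary, hence with the same sum on each di-circuit.
  When it takes values in \<open>{0, 1}\<close>, it is the indicator of the arcs whose orientation differs from the
  original one after \<open>F\<close> is reversed and then the dicuts given by \<open>\<pi>\<close> are reversed.
\<close>

definition shifted_indicator :: "('a, 'b) pre_digraph \<Rightarrow> 'b set \<Rightarrow> ('a \<Rightarrow> int) \<Rightarrow> 'b \<Rightarrow> int" where
  "shifted_indicator G F \<pi> e = of_bool (e \<in> F) + \<pi> (head G e) - \<pi> (tail G e)"

lemma (in wf_digraph) sum_shifted_indicator_dicircuit:
  assumes "dicircuit G K"
  shows "(\<Sum>e\<in>K. shifted_indicator G F \<pi> e) = int (card (F \<inter> K))"
proof -
  have "(\<Sum>e\<in>K. \<pi> (head G e)) = (\<Sum>v\<in>head G ` K. \<pi> v)"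
       "(\<Sum>e\<in>K. \<pi> (tail G e)) = (\<Sum>v\<in>tail G ` K. \<pi> v)"
    using dicircuit_ends(1,2)[OF assms] by (simp_all add: sum.reindex)
  then show ?thesis
    using dicircuit_ends(3)[OF assms] dicircuit_arcs(2)[OF assms]
    by (simp add: shifted_indicator_def sum.distrib sum_subtractf of_bool_def sum.If_cases Int_commute)
qed

lemma reverse_arcs_simps [simp]:
  "verts (reverse_arcs G R) = verts G" "arcs (reverse_arcs G R) = arcs G"
  "tail (reverse_arcs G R) e = (if e \<in> R then head G e else tail G e)"
  "head (reverse_arcs G R) e = (if e \<in> R then tail G e else head G e)"
  by (simp_all add: reverse_arcs_def)

lemma sink_set_reverse_arcs_iff:
  "sink_set (reverse_arcs G R) X \<longleftrightarrow> X \<subseteq> verts G \<and>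
     (\<forall>e \<in> arcs G. (tail G e \<in> X \<longrightarrow> e \<in> R) \<and> (head G e \<in> X \<longrightarrow> e \<notin> R))"
  unfolding sink_set_def out_arcs_def by auto

text \<open>
  From left to right, \<open>\<pi> v\<close> is the number of dicuts with \<open>v\<close> on the side they enter: no arc leaves that
  side, and by disjointness an arc enters it for at most one dicut.  From right to left, the dicuts are
  the cuts around the level sets \<open>{v. t \<le> \<pi> v}\<close>; an arc crosses at most one of them because \<open>\<pi>\<close> grows
  by at most 1 along it.  In both cases the union of the dicuts consists of the arcs along which \<open>\<pi>\<close>
  grows by 1, and \<open>X\<close> becomes a sink set iff this union contains the arcs leaving a node of \<open>X\<close>
  and none of those entering one.
\<close>

lemma (in wf_digraph) sink_stable_iff_potential:
  assumes "finite (arcs G)"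
  shows "sink_stable G X \<longleftrightarrow> X \<subseteq> verts G \<and>
    (\<exists>\<pi> :: 'a \<Rightarrow> int. \<forall>e \<in> arcs G. \<pi> (head G e) - \<pi> (tail G e) \<in> {0, 1} \<and>
       (tail G e \<in> X \<longrightarrow> \<pi> (head G e) - \<pi> (tail G e) = 1) \<and>
       (head G e \<in> X \<longrightarrow> \<pi> (head G e) - \<pi> (tail G e) = 0))"
    (is "_ \<longleftrightarrow> _ \<and> (\<exists>\<pi>. ?pot \<pi>)")
proof (intro iffI conjI)
  assume "sink_stable G X"
  then obtain \<C> where dicuts: "\<And>C. C \<in> \<C> \<Longrightarrow> dicut G C" and disj: "disjoint \<C>"
    and sink: "sink_set (reverse_arcs G (\<Union>\<C>)) X"
    unfolding sink_stable_def by blast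
  show "X \<subseteq> verts G"
    using sink by (simp add: sink_set_def)
  have "\<forall>C\<in>\<C>. \<exists>Z. leaving_arcs G Z = {} \<and> C = entering_arcs G Z"
    using dicuts unfolding dicut_def by blast
  then obtain Z where Z: "\<And>C. C \<in> \<C> \<Longrightarrow> leaving_arcs G (Z C) = {} \<and> C = entering_arcs G (Z C)"
    by metis
  have "\<C> \<subseteq> Pow (arcs G)"
    using Z unfolding entering_arcs_def by blast
  then have fin: "finite \<C>"
    using assms finite_subset by blast
  define \<pi> where "\<pi> v = int (card {C \<in> \<C>. v \<in> Z C})" for v
  have diff: "\<pi> (head G e) - \<pi> (tail G e) = of_bool (e \<in> \<Union>\<C>)" if e: "e \<in> arcs G" for e
  proof -
    have "{C \<in> \<C>. head G e \<in> Z C} = {C \<in> \<C>. tail G e \<in> Z C} \<union> {C \<in> \<C>. e \<in> C}"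
      using Z e unfolding leaving_arcs_def entering_arcs_def by blast
    moreover have "{C \<in> \<C>. tail G e \<in> Z C} \<inter> {C \<in> \<C>. e \<in> C} = {}"
      using Z unfolding entering_arcs_def by blast
    ultimately have "\<pi> (head G e) = \<pi> (tail G e) + int (card {C \<in> \<C>. e \<in> C})"
      using fin by (simp add: \<pi>_def card_Un_disjoint)
    moreover have "card {C \<in> \<C>. e \<in> C} = of_bool (e \<in> \<Union>\<C>)"
    proof (cases "e \<in> \<Union>\<C>")
      case True
      then obtain C where "C \<in> \<C>" "e \<in> C" by blast
      then have "{C \<in> \<C>. e \<in> C} = {C}"
        using disj unfolding disjoint_def by blast
      then show ?thesis using True by simp
    next
      case False
      then have empty: "{C \<in> \<C>. e \<in> C} = {}" by blast
      show ?thesis using False by (simp only: empty card.empty of_bool_eq)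
    qed
    ultimately show ?thesis by simp
  qed
  have "?pot \<pi>"
    using sink by (auto simp: diff sink_set_reverse_arcs_iff)
  then show "\<exists>\<pi>. ?pot \<pi>" by blast
next
  assume "X \<subseteq> verts G \<and> (\<exists>\<pi>. ?pot \<pi>)"
  then obtain \<pi> :: "'a \<Rightarrow> int" where X: "X \<subseteq> verts G" and pot: "?pot \<pi>" by blast
  define Z where "Z t = {v \<in> verts G. t \<le> \<pi> v}" for t
  define \<C> where "\<C> = range (\<lambda>t. entering_arcs G (Z t))"
  have entering: "e \<in> entering_arcs G (Z t) \<longleftrightarrow>
      e \<in> arcs G \<and> \<pi> (head G e) = t \<and> \<pi> (tail G e) = t - 1" for e t
    using pot by (fastforce simp: entering_arcs_def Z_def)
  have "dicut G C" if C: "C \<in> \<C>" for C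
  proof -
    obtain t where "C = entering_arcs G (Z t)"
      using C by (auto simp: \<C>_def)
    moreover have "leaving_arcs G (Z t) = {}"
      using pot by (fastforce simp: leaving_arcs_def Z_def)
    moreover have "Z t \<subseteq> verts G"
      by (auto simp: Z_def)
    ultimately show ?thesis
      unfolding dicut_def by blast
  qed
  moreover have "disjoint \<C>"
    by (auto simp: disjoint_def \<C>_def entering)
  moreover have union: "e \<in> \<Union>\<C> \<longleftrightarrow> \<pi> (head G e) - \<pi> (tail G e) = 1" if "e \<in> arcs G" for e
    using that by (auto simp: \<C>_def entering)
  have "sink_set (reverse_arcs G (\<Union>\<C>)) X"
    using X pot union by (simp add: sink_set_reverse_arcs_iff)
  ultimately show "sink_stable G X"
    unfolding sink_stable_def by blast
qed

text \<open>
  On an arc of \<open>F\<close> the reversed digraph sees the difference \<open>\<pi> (tail e) - \<pi> (head e) = 1 - c\<close>, where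
  \<open>c\<close> is the shifted indicator, and the arc leaves \<open>X\<close> where it used to enter it.  The two changes
  cancel, so the conditions on \<open>c\<close> are the same for arcs inside and outside \<open>F\<close>.
\<close>

lemma (in fin_digraph) F_stable_iff_shifted_indicator:
  "F_stable G F X \<longleftrightarrow> X \<subseteq> verts G \<and>
    (\<exists>\<pi>. \<forall>e \<in> arcs G. shifted_indicator G F \<pi> e \<in> {0, 1} \<and>
       (tail G e \<in> X \<longrightarrow> shifted_indicator G F \<pi> e = 1) \<and>
       (head G e \<in> X \<longrightarrow> shifted_indicator G F \<pi> e = 0))"
proof -
  interpret R: wf_digraph "reverse_arcs G F"
    by unfold_locales auto
  let ?H = "reverse_arcs G F"
  have "(let x = \<pi> (head ?H e) - \<pi> (tail ?H e) in
           x \<in> {0, 1} \<and> (tail ?H e \<in> X \<longrightarrow> x = 1) \<and> (head ?H e \<in> X \<longrightarrow> x = 0)) \<longleftrightarrow>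
        (let c = shifted_indicator G F \<pi> e in
           c \<in> {0, 1} \<and> (tail G e \<in> X \<longrightarrow> c = 1) \<and> (head G e \<in> X \<longrightarrow> c = 0))" for \<pi> e
    by (cases "e \<in> F") (auto simp: shifted_indicator_def Let_def)
  then show ?thesis
    unfolding F_stable_def by (simp add: R.sink_stable_iff_potential Let_def del: reverse_arcs_simps(3,4))
qed

lemma (in fin_digraph) F_stable_subset:
  "F_stable G F X \<Longrightarrow> Y \<subseteq> X \<Longrightarrow> F_stable G F Y"
  unfolding F_stable_iff_shifted_indicator by blast

section \<open>Necessity of the bound on di-circuits\<close>

lemma (in fin_digraph) card_F_stable_dicircuit_le:
  assumes "F_stable G F X" and K: "dicircuit G K"
  shows "card (X \<inter> dicircuit_verts G K) \<le> card (F \<inter> K)"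
proof -
  obtain \<pi> where \<pi>: "\<And>e. e \<in> arcs G \<Longrightarrow> shifted_indicator G F \<pi> e \<in> {0, 1}"
      "\<And>e. e \<in> arcs G \<Longrightarrow> tail G e \<in> X \<Longrightarrow> shifted_indicator G F \<pi> e = 1"
    using assms(1) unfolding F_stable_iff_shifted_indicator by blast
  have "int (card (X \<inter> dicircuit_verts G K)) = (\<Sum>e\<in>K. of_bool (tail G e \<in> X))"
    by (simp add: sum_tails_dicircuit[OF K])
  also have "\<dots> \<le> (\<Sum>e\<in>K. shifted_indicator G F \<pi> e)"
    using \<pi> dicircuit_arcs(1)[OF K] by (intro sum_mono) (fastforce simp: of_bool_def)
  also have "\<dots> = int (card (F \<inter> K))"
    by (rule sum_shifted_indicator_dicircuit[OF K])
  finally show ?thesis by simp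
qed

lemma (in fin_digraph) card_union_dicircuit_le:
  assumes "union_of_F_stable G F k S" and K: "dicircuit G K"
  shows "card (S \<inter> dicircuit_verts G K) \<le> k * card (F \<inter> K)"
proof -
  obtain T where T: "\<And>i. i < k \<Longrightarrow> F_stable G F (T i)" and S: "S = (\<Union>i<k. T i)"
    using assms(1) unfolding union_of_F_stable_def by blast
  have "card (S \<inter> dicircuit_verts G K) = card (\<Union>i<k. T i \<inter> dicircuit_verts G K)"
    by (simp add: S)
  also have "\<dots> \<le> (\<Sum>i<k. card (T i \<inter> dicircuit_verts G K))"
    by (rule card_UN_le) simp
  also have "\<dots> \<le> (\<Sum>i<k. card (F \<inter> K))"
    using T card_F_stable_dicircuit_le[OF _ K] by (intro sum_mono) simp
  finally show ?thesis by simp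
qed

section \<open>Potentials from nonnegative di-circuits\<close>

text \<open>
  Take as \<open>d v\<close> the least weight of a path, with any starting node, that ends at \<open>v\<close>.  The minimum exists
  because there are finitely many paths, unlike walks.  The price is that appending an arc \<open>e\<close> to
  a path may revisit \<open>head e\<close>; the part of the path from there on forms a di-circuit with \<open>e\<close>, and
  dropping it does not increase the weight.
\<close>

lemma (in fin_digraph) feasible_potential:
  fixes w :: "'b \<Rightarrow> int"
  assumes nonneg: "\<And>K. dicircuit G K \<Longrightarrow> 0 \<le> (\<Sum>e\<in>K. w e)"
  obtains d where "\<And>e. e \<in> arcs G \<Longrightarrow> d (head G e) \<le> d (tail G e) + w e"
proof -
  define costs where "costs v = {sum_list (map w p) | u p. apath u p v}" for v
  define d where "d v = Min (costs v)" for v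
  have "costs v \<subseteq> (\<lambda>(u, p, v). sum_list (map w p)) ` {(u, p, v). apath u p v}" for v
    by (force simp: costs_def)
  then have fin: "finite (costs v)" for v
    using apaths_finite_triple by (meson finite_imageI finite_subset)
  have le: "d v \<le> sum_list (map w p)" if "apath u p v" for u p v
    unfolding d_def using fin that by (intro Min_le) (auto simp: costs_def)
  have "d (head G e) \<le> d (tail G e) + w e" if e: "e \<in> arcs G" for e
  proof -
    have "sum_list (map w []) \<in> costs (tail G e)"
      unfolding costs_def using e by (fastforce simp: apath_Nil_iff)
    then have "d (tail G e) \<in> costs (tail G e)"
      unfolding d_def using fin by (intro Min_in) auto
    then obtain u p where p: "apath u p (tail G e)" and dp: "d (tail G e) = sum_list (map w p)"
      by (auto simp: costs_def)
    have walk: "awalk u p (tail G e)"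
      using p by (rule awalkI_apath)
    show ?thesis
    proof (cases "head G e \<in> set (awalk_verts u p)")
      case False
      have ext: "awalk u (p @ [e]) (head G e)"
        using walk arc_implies_awalk[OF e] by (rule awalk_appendI)
      then have "apath u (p @ [e]) (head G e)"
        using p False by (auto simp: apath_def awalk_verts_append)
      from le[OF this] show ?thesis
        by (simp add: dp)
    next
      case True
      then obtain q r where qr: "p = q @ r" "awalk u q (head G e)" "awalk (head G e) r (tail G e)"
        using awalk_decomp[OF walk] by blast
      have q: "apath u q (head G e)" and r: "apath (head G e) r (tail G e)"
        using p qr by (auto simp: apath_append_iff awlast_of_awalk)
      have "awalk (tail G e) (e # r) (tail G e)"
        using e qr(3) by (simp add: awalk_Cons_iff)
      moreover have dist: "distinct (tl (awalk_verts (tail G e) (e # r)))"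
        using r by (simp add: apath_def)
      ultimately have cyc: "cycle (e # r)"
        unfolding cycle_def by blast
      then have "dicircuit G (set (e # r))"
        unfolding dicircuit_def by blast
      moreover have "distinct (e # r)"
        using cyc by (auto simp: cycle_conv)
      ultimately have "0 \<le> sum_list (map w (e # r))"
        using nonneg sum_list_distinct_conv_sum_set by metis
      then show ?thesis
        using le[OF q] by (simp add: dp qr(1))
    qed
  qed
  then show ?thesis using that by blast
qed

section \<open>Splitting into stable sets\<close>

text \<open>
  Every arc \<open>e\<close> is cyclic by strong connectivity, so by flatness it lies on a di-circuit meeting \<open>F\<close>
  once.  On this di-circuit the nonnegative values of \<open>c\<close> sum to 1, so \<open>c e \<le> 1\<close>.  If \<open>e\<close> enters a node of \<open>X\<close>, then the
  next arc of the di-circuit leaves this node and uses up the whole sum, so \<open>c e = 0\<close>.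
\<close>

lemma F_stable_if_shifted_indicator_ge:
  assumes "fin_digraph G" "loopfree_digraph G" "strongly_connected G" "flat G F"
    and X: "X \<subseteq> verts G"
    and ge: "\<And>e. e \<in> arcs G \<Longrightarrow> of_bool (tail G e \<in> X) \<le> shifted_indicator G F \<pi> e"
  shows "F_stable G F X"
proof -
  interpret fin_digraph G by fact
  interpret loopfree_digraph G by fact
  let ?c = "shifted_indicator G F \<pi>"
  have nonneg: "0 \<le> ?c e" if "e \<in> arcs G" for e
    using ge[OF that] by (auto split: if_splits simp: of_bool_def)
  have "?c e \<le> 1 \<and> (head G e \<in> X \<longrightarrow> ?c e \<le> 0)" if e: "e \<in> arcs G" for e
  proof -
    obtain K where K: "dicircuit G K" "e \<in> K" "card (F \<inter> K) = 1"
      using cyclic_arc_if_strongly_connected[OF assms(3) e] assms(4) unfolding flat_def by blast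
    have fin: "finite K" and sub: "K \<subseteq> arcs G"
      using dicircuit_arcs[OF K(1)] by auto
    have sum: "(\<Sum>a\<in>K. ?c a) = 1"
      using sum_shifted_indicator_dicircuit[OF K(1)] K(3) by simp
    have "?c e \<le> (\<Sum>a\<in>K. ?c a)"
      using fin sub nonneg K(2) by (intro member_le_sum) auto
    moreover have "?c e \<le> 0" if "head G e \<in> X"
    proof -
      obtain a where a: "a \<in> K" "tail G a = head G e"
        using dicircuit_ends(3)[OF K(1)] K(2) by (metis imageE imageI)
      \<comment> \<open>A loop would be its own successor, and \<open>c\<close> could then be 1 on it.\<close>
      have "a \<noteq> e"
        using a no_loops[OF e] by auto
      then have "?c a + ?c e = (\<Sum>b\<in>{a, e}. ?c b)"
        by simp
      also have "\<dots> \<le> (\<Sum>b\<in>K. ?c b)"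
        using fin sub nonneg K(2) a(1) by (intro sum_mono2) auto
      finally have "?c a + ?c e \<le> 1"
        using sum by simp
      moreover have "1 \<le> ?c a"
        using ge[of a] a sub that by auto
      ultimately show ?thesis by simp
    qed
    ultimately show ?thesis using sum by simp
  qed
  moreover have "1 \<le> ?c e" if "e \<in> arcs G" "tail G e \<in> X" for e
    using ge[OF that(1)] that(2) by simp
  ultimately have "\<forall>e \<in> arcs G. ?c e \<in> {0, 1} \<and> (tail G e \<in> X \<longrightarrow> ?c e = 1) \<and> (head G e \<in> X \<longrightarrow> ?c e = 0)"
    using nonneg by (smt (verit) insert_iff)
  then show ?thesis
    using X F_stable_iff_shifted_indicator by blast
qed

text \<open>
  The potential \<open>-d\<close>, scaled down by \<open>k\<close> with rounding offset \<open>i\<close>, serves the \<open>i\<close>-th set.  That set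
  consists of the nodes of \<open>S\<close> at which raising the potential by 1 raises its rounded value.
\<close>

lemma union_of_F_stable_if_card_le:
  assumes "fin_digraph G" "loopfree_digraph G" "strongly_connected G" "flat G F"
    and S: "S \<subseteq> verts G" and k: "k \<ge> 1"
    and bound: "\<And>K. dicircuit G K \<Longrightarrow> card (S \<inter> dicircuit_verts G K) \<le> k * card (F \<inter> K)"
  shows "union_of_F_stable G F k S"
proof -
  interpret fin_digraph G by fact
  define w :: "'b \<Rightarrow> int" where "w e = int k * of_bool (e \<in> F) - of_bool (tail G e \<in> S)" for e
  have "0 \<le> (\<Sum>e\<in>K. w e)" if K: "dicircuit G K" for K
  proof -
    have "(\<Sum>e\<in>K. of_bool (e \<in> F) :: int) = int (card (F \<inter> K))"
      using dicircuit_arcs(2)[OF K] by (simp add: of_bool_def sum.If_cases Int_commute)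
    then have "(\<Sum>e\<in>K. w e) = int (k * card (F \<inter> K)) - int (card (S \<inter> dicircuit_verts G K))"
      by (simp add: w_def sum_subtractf sum_tails_dicircuit[OF K] flip: sum_distrib_left)
    also have "\<dots> \<ge> 0"
      using bound[OF K] by linarith
    finally show ?thesis .
  qed
  then obtain d where d: "\<And>e. e \<in> arcs G \<Longrightarrow> d (head G e) \<le> d (tail G e) + w e"
    using feasible_potential by blast
  define \<pi> where "\<pi> i v = (int i - d v) div int k" for i :: nat and v
  define T where "T i = {v \<in> S. int k dvd int i - d v + 1}" for i :: nat
  have stable: "F_stable G F (T i)" for i
  proof (rule F_stable_if_shifted_indicator_ge[OF assms(1-4)])
    show "T i \<subseteq> verts G"
      using S by (auto simp: T_def)
    fix e assume e: "e \<in> arcs G"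
    let ?a = "int i - d (tail G e)" and ?b = "int i - d (head G e)"
    have le: "?a + of_bool (tail G e \<in> S) \<le> ?b + of_bool (e \<in> F) * int k"
      using d[OF e] by (simp add: w_def mult.commute)
    \<comment> \<open>At a node of \<open>T i\<close>, \<open>?a + 1\<close> is a multiple of \<open>k\<close>, so adding 1 to \<open>?a\<close> raises the quotient.\<close>
    have "of_bool (tail G e \<in> T i) + ?a div int k \<le> (?a + of_bool (tail G e \<in> S)) div int k"
    proof (cases "tail G e \<in> T i")
      case True
      then obtain m where m: "?a + 1 = int k * m"
        by (auto simp: T_def dvd_def)
      then have "?a = int k * (m - 1) + (int k - 1)"
        by (simp add: algebra_simps)
      then have "?a div int k = m - 1"
        using k by (intro int_div_pos_eq) auto
      then show ?thesis
        using True m k by (simp add: T_def)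
    next
      case False
      then show ?thesis
        using k by (simp add: zdiv_mono1)
    qed
    also have "\<dots> \<le> (?b + of_bool (e \<in> F) * int k) div int k"
      using le k by (intro zdiv_mono1) auto
    also have "\<dots> = of_bool (e \<in> F) + ?b div int k"
      using k by simp
    finally show "of_bool (tail G e \<in> T i) \<le> shifted_indicator G F (\<pi> i) e"
      by (simp add: shifted_indicator_def \<pi>_def)
  qed
  have union: "S = (\<Union>i<k. T i)"
  proof
    show "S \<subseteq> (\<Union>i<k. T i)"
    proof
      fix v assume v: "v \<in> S"
      \<comment> \<open>The residue that makes \<open>int i - d v + 1\<close> divisible by \<open>k\<close>.\<close>
      define i where "i = nat ((d v - 1) mod int k)"
      have i: "int i = (d v - 1) mod int k"
        using k by (simp add: i_def)
      have "((d v - 1) mod int k) mod int k = (d v - 1) mod int k"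
        by (rule mod_mod_trivial)
      then have "int k dvd int i - (d v - 1)"
        unfolding i mod_eq_dvd_iff .
      then have "v \<in> T i"
        using v by (simp add: T_def algebra_simps)
      moreover have "i < k"
        using k pos_mod_bound[of "int k" "d v - 1"] by (simp add: i[symmetric])
      ultimately show "v \<in> (\<Union>i<k. T i)" by blast
    qed
  qed (auto simp: T_def)
  show ?thesis
    unfolding union_of_F_stable_def by (intro exI[of _ T] conjI allI impI stable union)
qed

section \<open>Covers by stable sets\<close>

text \<open>
  Only an inequality for the size, since the sets of the union may coincide.
\<close>

lemma F_stable_cover_if_union:
  assumes "union_of_F_stable G F n S"
  shows "\<exists>\<T>. F_stable_cover G F S \<T> \<and> card \<T> \<le> n"
proof -
  obtain T where T: "\<And>i. i < n \<Longrightarrow> F_stable G F (T i)" "S = (\<Union>i<n. T i)"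
    using assms unfolding union_of_F_stable_def by blast
  have "F_stable_cover G F S (T ` {..<n})"
    using T by (auto simp: F_stable_cover_def)
  moreover have "card (T ` {..<n}) \<le> n"
    using card_image_le[of "{..<n}" T] by simp
  ultimately show ?thesis by blast
qed

text \<open>
  The members of a cover may stick out of \<open>S\<close>; cutting them down to \<open>S\<close> keeps them stable.
\<close>

lemma (in fin_digraph) union_of_F_stable_if_cover:
  assumes "F_stable_cover G F S \<T>"
  shows "union_of_F_stable G F (card \<T>) S"
proof -
  obtain h where "bij_betw h {0..<card \<T>} \<T>"
    using assms ex_bij_betw_nat_finite unfolding F_stable_cover_def by blast
  then have h: "h ` {..<card \<T>} = \<T>"
    by (simp add: bij_betw_def atLeast0LessThan)
  have "F_stable G F (S \<inter> h i)" if "i < card \<T>" for i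
  proof -
    have "h i \<in> \<T>"
      using h that by blast
    then have "F_stable G F (h i)"
      using assms by (simp add: F_stable_cover_def)
    then show ?thesis
      by (rule F_stable_subset) simp
  qed
  moreover have "S = (\<Union>i<card \<T>. S \<inter> h i)"
  proof -
    have "S = S \<inter> \<Union>(h ` {..<card \<T>})"
      using assms by (auto simp: F_stable_cover_def h)
    then show ?thesis by simp
  qed
  ultimately show ?thesis
    unfolding union_of_F_stable_def by (intro exI[of _ "\<lambda>i. S \<inter> h i"]) blast
qed

theorem theorem3p5:
  fixes D :: "('a, 'b) pre_digraph" and F :: "'b set" and S :: "'a set"
  assumes "fin_digraph D" and "loopfree_digraph D"
    and "strongly_connected D"
    and "flat D F"
    and "S \<subseteq> verts D"
  shows "(\<forall>k::nat. k \<ge> 1 \<longrightarrow>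
            (union_of_F_stable D F k S \<longleftrightarrow>
             (\<forall>K. dicircuit D K \<longrightarrow> card (S \<inter> dicircuit_verts D K) \<le> k * card (F \<inter> K))))
       \<and> (card (verts D) \<ge> 2 \<and> flat_transversal D F \<longrightarrow>
            (\<exists>\<T>. F_stable_cover D F S \<T>) \<and>
            int (LEAST n. \<exists>\<T>. F_stable_cover D F S \<T> \<and> card \<T> = n) =
            Max {\<lceil>real (card (S \<inter> dicircuit_verts D K)) / real (card (F \<inter> K))\<rceil> | K. dicircuit D K})"
proof (intro conjI impI allI)
  interpret fin_digraph D by fact
  interpret loopfree_digraph D by fact
  show union_iff: "union_of_F_stable D F k S \<longleftrightarrow>
      (\<forall>K. dicircuit D K \<longrightarrow> card (S \<inter> dicircuit_verts D K) \<le> k * card (F \<inter> K))"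
    if "k \<ge> 1" for k :: nat
    using that card_union_dicircuit_le union_of_F_stable_if_card_le[OF assms] by blast
  assume "card (verts D) \<ge> 2 \<and> flat_transversal D F"
  then have two: "card (verts D) \<ge> 2" and trans: "\<And>K. dicircuit D K \<Longrightarrow> F \<inter> K \<noteq> {}"
    by (auto simp: flat_transversal_def)
  define ratio where
    "ratio K = \<lceil>real (card (S \<inter> dicircuit_verts D K)) / real (card (F \<inter> K))\<rceil>" for K
  define M where "M = Max {ratio K | K. dicircuit D K}"
  have "{ratio K | K. dicircuit D K} \<subseteq> ratio ` Pow (arcs D)"
    using dicircuit_arcs(1) by blast
  then have fin: "finite {ratio K | K. dicircuit D K}"
    using finite_arcs by (meson finite_Pow_iff finite_imageI finite_subset)
  have "verts D \<noteq> {}"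
    using two by auto
  then obtain K0 where K0: "dicircuit D K0"
    using dicircuit_through_vertex[OF assms(3) two] by blast
  have "real_of_int (0 :: int) \<le> real (card (S \<inter> dicircuit_verts D K0)) / real (card (F \<inter> K0))"
    by simp
  then have "0 \<le> ratio K0"
    unfolding ratio_def by (metis ceiling_mono ceiling_of_int)
  also have "\<dots> \<le> M"
    unfolding M_def using fin K0 by (intro Max_ge) auto
  finally have M0: "0 \<le> M" .
  have ratio_le: "ratio K \<le> int n \<longleftrightarrow> card (S \<inter> dicircuit_verts D K) \<le> n * card (F \<inter> K)"
    if K: "dicircuit D K" for K n
  proof -
    have "0 < card (F \<inter> K)"
      using trans[OF K] dicircuit_arcs(2)[OF K] by (simp add: card_gt_0_iff)
    then show ?thesis
      by (simp add: ratio_def ceiling_le_iff divide_le_eq flip: of_nat_mult)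
  qed
  have M_le: "M \<le> int n \<longleftrightarrow>
      (\<forall>K. dicircuit D K \<longrightarrow> card (S \<inter> dicircuit_verts D K) \<le> n * card (F \<inter> K))" for n
    unfolding M_def using fin K0 ratio_le by (subst Max_le_iff) blast+
  \<comment> \<open>The first part speaks of \<open>k \<ge> 1\<close> only; the maximum 0 belongs to the empty cover of the empty set.\<close>
  have union_M: "union_of_F_stable D F (nat M) S"
  proof (cases "nat M \<ge> 1")
    case True
    then show ?thesis
      using union_iff M_le[of "nat M"] M0 by simp
  next
    case False
    then have "M \<le> int 0"
      by linarith
    then have zero: "card (S \<inter> dicircuit_verts D K) = 0" if "dicircuit D K" for K
      unfolding M_le using that by simp
    have "S = {}"
    proof (rule ccontr)
      assume "S \<noteq> {}"
      then obtain v where v: "v \<in> S" by blast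
      then obtain K where K: "dicircuit D K" "v \<in> dicircuit_verts D K"
        using dicircuit_through_vertex[OF assms(3) two] assms(5) by blast
      moreover have "finite (dicircuit_verts D K)"
        using dicircuit_arcs(2)[OF K(1)] by (simp add: dicircuit_verts_def)
      ultimately show False
        using zero[OF K(1)] v by auto
    qed
    then show ?thesis
      using False by (simp add: union_of_F_stable_def)
  qed
  have lower: "nat M \<le> card \<T>" if "F_stable_cover D F S \<T>" for \<T>
    using M_le card_union_dicircuit_le[OF union_of_F_stable_if_cover[OF that]] by (simp add: nat_le_iff)
  obtain \<T> where \<T>: "F_stable_cover D F S \<T>" "card \<T> \<le> nat M"
    using F_stable_cover_if_union[OF union_M] by blast
  then have "card \<T> = nat M"
    using lower by (simp add: le_antisym)
  then have "(LEAST n. \<exists>\<T>. F_stable_cover D F S \<T> \<and> card \<T> = n) = nat M"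
    using \<T>(1) lower by (intro Least_equality) auto
  then show "int (LEAST n. \<exists>\<T>. F_stable_cover D F S \<T> \<and> card \<T> = n) =
      Max {\<lceil>real (card (S \<inter> dicircuit_verts D K)) / real (card (F \<inter> K))\<rceil> | K. dicircuit D K}"
    using M0 by (simp add: M_def ratio_def)
  show "\<exists>\<T>. F_stable_cover D F S \<T>"
    using \<T>(1) by blast
qed

end
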